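(* For every $n\ge3$ and every $k\in\{2,\dots,n-1\}$ there exist $\bar p\in(0,1)$ and origin symmetric convex bodies $K_0,K_1\subset\mathbb{R}^n$ such that for every $p\in(0,\bar p)$ $$V_k\left(\tfrac12\cdot K_0+_p\tfrac12\cdot K_1\right)^{\frac pk}<\frac12V_k(K_0)^{\frac pk}+\frac12V_k(K_1)^{\frac pk}.$$ In particular, for every $p\in(0,\bar p)$ the $p$-Brunn-Minkowski inequality $V_k((1-t)\cdot L_0+_pt\cdot L_1)^{p/k}\ge(1-t)V_k(L_0)^{p/k}+tV_k(L_1)^{p/k}$ (for all $t\in[0,1]$ and all origin symmetric convex bodies $L_0,L_1$ in $\mathbb{R}^n$) does not hold.
   Context: A convex body in $\mathbb{R}^n$ is a nonempty compact convex subset of $\mathbb{R}^n$ (possibly with empty interior). The support function of a convex body $K$ is $h_K(x)=\sup\{(x,y):y\in K\}$, $x\in\mathbb{S}^{n-1}$, where $\mathbb{S}^{n-1}$ is the unit sphere and $(\cdot,\cdot)$ is the standard scalar product. $K$ is origin symmetric if $K=-K$ (so $h_K\ge0$). For $p\in(0,1)$, origin symmetric convex bodies $K_0,K_1$ and $t\in[0,1]$, the $p$-combination is the Wulff shape $$(1-t)\cdot K_0+_pt\cdot K_1=\{x\in\mathbb{R}^n:(x,y)\le \big((1-t)h_{K_0}(y)^p+t\,h_{K_1}(y)^p\big)^{1/p}\ \ \forall y\in\mathbb{S}^{n-1}\}.$$ $V_k$ denotes the $k$-th intrinsic volume, defined through the Steiner formula $\mathcal{L}^n(K+\varepsilon B_n)=\sum_{k=0}^n\varepsilon^{n-k}\kappa_{n-k}V_k(K)$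 for $\varepsilon\ge0$, where $B_n$ is the closed unit ball, $\mathcal{L}^n$ is Lebesgue measure and $\kappa_j$ is the $j$-dimensional volume of the unit ball of $\mathbb{R}^j$. *)

theory Defs
  imports "HOL-Analysis.Analysis"
begin

definition convex_body :: "'a::euclidean_space set \<Rightarrow> bool" where
  "convex_body K \<longleftrightarrow> K \<noteq> {} \<and> compact K \<and> convex K"

definition origin_symmetric :: "'a::euclidean_space set \<Rightarrow> bool" where
  "origin_symmetric K \<longleftrightarrow> K = uminus ` K"

definition support_function :: "'a::euclidean_space set \<Rightarrow> 'a \<Rightarrow> real" where
  "support_function K x = (SUP y\<in>K. x \<bullet> y)"

text \<open>\<open>p_combination p t K0 K1\<close> is the Wulff shape \<open>(1 - t) \<cdot> K0 +\<^sub>p t \<cdot> K1\<close>. For \<open>p > 0\<close> the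
  convention \<open>0 powr p = 0\<close> agrees with the usual power of a nonnegative number.\<close>

definition p_combination ::
  "real \<Rightarrow> real \<Rightarrow> 'a::euclidean_space set \<Rightarrow> 'a set \<Rightarrow> 'a set" where
  "p_combination p t K0 K1 =
     {x. \<forall>y\<in>sphere 0 1. x \<bullet> y \<le>
        ((1 - t) * support_function K0 y powr p + t * support_function K1 y powr p) powr (1 / p)}"

definition steiner_formula :: "'a::euclidean_space set \<Rightarrow> (nat \<Rightarrow> real) \<Rightarrow> bool" where
  "steiner_formula K V \<longleftrightarrow>
     (\<forall>\<epsilon>\<ge>0. measure lebesgue {x + \<epsilon> *\<^sub>R b | x b. x \<in> K \<and> b \<in> cball 0 1} =
        (\<Sum>k = 0..DIM('a). \<epsilon> ^ (DIM('a) - k) * unit_ball_vol (real (DIM('a) - k)) * V k))"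

text \<open>For \<open>k \<le> DIM('a)\<close> the Steiner formula determines \<open>V k\<close> (see
  \<open>intrinsic_volume_eqI\<close> below); that some such \<open>V\<close> exists for every convex body is Steiner's
  theorem. The value is unspecified for \<open>k > DIM('a)\<close>.\<close>

definition intrinsic_volume :: "nat \<Rightarrow> 'a::euclidean_space set \<Rightarrow> real" where
  "intrinsic_volume k K = (THE v. \<exists>V. steiner_formula K V \<and> v = V k)"

lemma steiner_formula_unique:
  fixes K :: "'a::euclidean_space set"
  assumes V: "steiner_formula K V" and W: "steiner_formula K W" and k: "k \<le> DIM('a)"
  shows "V k = W k"
proof -
  define n where "n = DIM('a)"
  define c where "c j = unit_ball_vol (real j) * (V (n - j) - W (n - j))" for j
  have zero: "(\<Sum>j\<le>n. c j * e ^ j) = 0" if "e \<ge> 0" for e :: real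
  proof -
    have "(\<Sum>k = 0..n. e ^ (n - k) * unit_ball_vol (real (n - k)) * V k)
        = (\<Sum>k = 0..n. e ^ (n - k) * unit_ball_vol (real (n - k)) * W k)"
      using V W that unfolding steiner_formula_def n_def by (metis (no_types, lifting))
    hence "(\<Sum>k = 0..n. e ^ (n - k) * unit_ball_vol (real (n - k)) * (V k - W k)) = 0"
      by (simp add: right_diff_distrib sum_subtractf)
    moreover have "(\<Sum>j\<le>n. c j * e ^ j)
        = (\<Sum>k = 0..n. e ^ (n - k) * unit_ball_vol (real (n - k)) * (V k - W k))"
      by (rule sum.reindex_bij_witness[of _ "\<lambda>j. n - j" "\<lambda>j. n - j"]) (auto simp: c_def)
    ultimately show ?thesis by simp
  qed
  have "infinite {e::real. (\<Sum>j\<le>n. c j * e ^ j) = 0}"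
    using zero by (intro infinite_super[OF _ infinite_Ici[of 0]]) auto
  hence "c (n - k) = 0"
    using polyfun_finite_roots[of c n] by (metis diff_le_self)
  moreover have "unit_ball_vol (real (n - k)) \<noteq> 0"
    using unit_ball_vol_pos by (metis of_nat_0_le_iff less_irrefl)
  moreover have "n - (n - k) = k" using k by (simp add: n_def)
  ultimately show ?thesis unfolding c_def by simp
qed

lemma intrinsic_volume_eqI:
  fixes K :: "'a::euclidean_space set"
  assumes "steiner_formula K V" and "k \<le> DIM('a)"
  shows "intrinsic_volume k K = V k"
  unfolding intrinsic_volume_def
  using assms by (blast intro: the_equality dest: steiner_formula_unique)

end

(* Let C be a set of k - 1 coordinate directions, u and v two further ones, and let K0 and K1 be
   the k-dimensional cubes [-1,1]^k spanned by C and u, and by C and v. For p <= 1 the reverse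
   Minkowski inequality shows that the p-mean of their support functions dominates the support
   function of the box with half-widths 1 on C and s = (1/2)^(1/p) on u and v, while testing the
   p-mean at the unit vectors gives the converse inclusion: the p-combination is this box. The
   k-th intrinsic volume of a box is the k-th elementary symmetric polynomial of its side lengths,
   so V_k (K0) = V_k (K1) = 2^k, whereas for the p-combination every term contains a factor s. As
   p tends to 0, s is eventually smaller than 1 / (n choose k), and V_k drops below 2^k. *)
theory Submission
  imports Defs
begin

subsection \<open>The Steiner formula for boxes\<close>

text \<open>For \<open>a \<ge> 0\<close> this is the distance from \<open>t\<close> to
  \<open>[-a, a]\<close>, so the squared distance of a point to a box is the sum of its squares over
  the coordinates.\<close>

definition dist_interval :: "real \<Rightarrow> real \<Rightarrow> real" where
  "dist_interval a t = max (\<bar>t\<bar> - a) 0"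

lemma dist_interval_nonneg [simp]: "0 \<le> dist_interval a t"
  by (simp add: dist_interval_def)

lemma borel_measurable_dist_interval [measurable]: "dist_interval a \<in> borel_measurable borel"
  unfolding dist_interval_def by measurable

text \<open>Cutting \<open>[-a, a]\<close> out of the line and gluing the two remaining half-lines together.\<close>

lemma nn_integral_dist_interval:
  fixes F :: "real \<Rightarrow> ennreal"
  assumes [measurable]: "F \<in> borel_measurable borel" and a: "0 \<le> a"
  shows "(\<integral>\<^sup>+t. F (dist_interval a t) \<partial>lborel) = ennreal (2 * a) * F 0 + (\<integral>\<^sup>+t. F \<bar>t\<bar> \<partial>lborel)"
proof -
  \<comment> \<open>The sign of \<open>c\<close> selects a half-line: \<open>G 1\<close> is the part
    of \<open>F \<bar>t\<bar>\<close> on \<open>t > 0\<close>, \<open>G (-1)\<close> the part on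
    \<open>t < 0\<close>.\<close>
  define G where "G c t = F \<bar>t\<bar> * indicator {0<..} (c * t)" for c t :: real
  have G_measurable [measurable]: "G c \<in> borel_measurable borel" for c
    unfolding G_def by measurable
  have shift: "(\<integral>\<^sup>+t. G c (t - b) \<partial>lborel) = (\<integral>\<^sup>+t. G c t \<partial>lborel)" for b c
    using nn_integral_real_affine[of "G c" 1 "-b"] by (simp add: algebra_simps)
  have halves: "(\<integral>\<^sup>+t. F \<bar>t\<bar> \<partial>lborel) = (\<integral>\<^sup>+t. G 1 t \<partial>lborel) + (\<integral>\<^sup>+t. G (-1) t \<partial>lborel)"
  proof -
    have "AE t in lborel. t \<noteq> (0::real)"
      using AE_lborel_singleton by auto
    then have "(\<integral>\<^sup>+t. F \<bar>t\<bar> \<partial>lborel) = (\<integral>\<^sup>+t. G 1 t + G (-1) t \<partial>lborel)"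
      by (intro nn_integral_cong_AE) (auto elim!: eventually_mono simp: G_def indicator_def)
    then show ?thesis by (simp add: nn_integral_add)
  qed
  have "(\<integral>\<^sup>+t. F (dist_interval a t) \<partial>lborel)
      = (\<integral>\<^sup>+t. F 0 * indicator {-a..a} t + (G 1 (t - a) + G (-1) (t - (-a))) \<partial>lborel)"
    \<comment> \<open>Right of \<open>a\<close> the distance is \<open>t - a\<close>, left of
      \<open>-a\<close> it is \<open>-(t + a)\<close>: each outer half-line is a translate of one at
      the origin.\<close>
    using a by (intro nn_integral_cong) (auto simp: G_def dist_interval_def indicator_def max_def abs_if)
  also have "\<dots> = F 0 * emeasure lborel {-a..a} + ((\<integral>\<^sup>+t. G 1 (t - a) \<partial>lborel) + (\<integral>\<^sup>+t. G (-1) (t - (-a)) \<partial>lborel))"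
    by (subst nn_integral_add, simp, simp, subst nn_integral_add) (auto simp: nn_integral_cmult_indicator)
  also have "\<dots> = ennreal (2 * a) * F 0 + (\<integral>\<^sup>+t. F \<bar>t\<bar> \<partial>lborel)"
    unfolding shift halves using a by (simp add: mult.commute)
  finally show ?thesis .
qed

text \<open>Cavalieri's principle for the ball of radius \<open>r\<close> in dimension
  \<open>m + 1\<close>: its slice at height \<open>t\<close> is an \<open>m\<close>-dimensional ball
  of radius \<open>sqrt (r\<^sup>2 - t\<^sup>2)\<close>. Rescaling to \<open>r = 1\<close> leaves a
  Beta integral.\<close>

lemma nn_integral_ball_slices:
  fixes r :: real
  assumes r: "0 \<le> r"
  shows "(\<integral>\<^sup>+t. ennreal (indicator {-r..r} t * (unit_ball_vol (real m) * sqrt (r\<^sup>2 - t\<^sup>2) ^ m)) \<partial>lborel) =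
    ennreal (unit_ball_vol (real (Suc m)) * r ^ Suc m)"
\<comment> \<open>The substitution \<open>r * t\<close> needs \<open>r \<noteq> 0\<close>. For
  \<open>r = 0\<close> the integrand lives on the null set \<open>{0}\<close>, where it need not
  vanish: for \<open>m = 0\<close> its power is \<open>0 ^ 0 = 1\<close>.\<close>
proof (cases "r = 0")
  case True
  have "AE t in lborel. t \<noteq> (0::real)"
    using AE_lborel_singleton by auto
  then have "(\<integral>\<^sup>+t. ennreal (indicator {-r..r} t * (unit_ball_vol (real m) * sqrt (r\<^sup>2 - t\<^sup>2) ^ m)) \<partial>lborel) =
     (\<integral>\<^sup>+t. 0 \<partial>(lborel :: real measure))"
    using True by (intro nn_integral_cong_AE) (auto elim!: eventually_mono)
  then show ?thesis using True by simp
next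
  case False
  with r have r: "r > 0" by simp
  have "(\<integral>\<^sup>+t. ennreal (indicator {-r..r} t * (unit_ball_vol (real m) * sqrt (r\<^sup>2 - t\<^sup>2) ^ m)) \<partial>lborel) =
    ennreal r * (\<integral>\<^sup>+t. ennreal (indicator {-r..r} (r * t) * (unit_ball_vol (real m) * sqrt (r\<^sup>2 - (r * t)\<^sup>2) ^ m)) \<partial>lborel)"
    using r by (subst nn_integral_real_affine[of _ r 0]) auto
  also have "(\<integral>\<^sup>+t. ennreal (indicator {-r..r} (r * t) * (unit_ball_vol (real m) * sqrt (r\<^sup>2 - (r * t)\<^sup>2) ^ m)) \<partial>lborel)
    = (\<integral>\<^sup>+t. ennreal (unit_ball_vol (real m) * r ^ m) * ennreal (indicator {-1..1} t * sqrt (1 - t\<^sup>2) ^ m) \<partial>lborel)"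
  proof (rule nn_integral_cong)
    fix t :: real
    have "indicator {-r..r} (r * t) = (indicator {-1..1} t :: real)"
      using r mult_le_cancel_left_pos[of r t 1] mult_le_cancel_left_pos[of r "-1" t]
      by (auto simp: indicator_def)
    moreover have "sqrt (r\<^sup>2 - (r * t)\<^sup>2) = r * sqrt (1 - t\<^sup>2)"
    proof -
      have "r\<^sup>2 - (r * t)\<^sup>2 = r\<^sup>2 * (1 - t\<^sup>2)" by (simp add: algebra_simps power_mult_distrib)
      then show ?thesis using r by (simp add: real_sqrt_mult)
    qed
    ultimately show "ennreal (indicator {-r..r} (r * t) * (unit_ball_vol (real m) * sqrt (r\<^sup>2 - (r * t)\<^sup>2) ^ m))
      = ennreal (unit_ball_vol (real m) * r ^ m) * ennreal (indicator {-1..1} t * sqrt (1 - t\<^sup>2) ^ m)"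
      using r by (simp add: ennreal_mult'[symmetric] power_mult_distrib mult_ac)
  qed
  also have "\<dots> = ennreal (unit_ball_vol (real m) * r ^ m) * ennreal (Beta (1 / 2) (real m / 2 + 1))"
    by (subst nn_integral_cmult) (auto simp: emeasure_cball_aux_integral)
  also have "ennreal r * \<dots> = ennreal (unit_ball_vol (real m) * Beta (1 / 2) (real m / 2 + 1) * r ^ Suc m)"
    using r by (simp add: ennreal_mult'[symmetric] mult_ac)
  \<comment> \<open>The recursion between consecutive ball volumes, by writing \<open>Beta\<close>
    through \<open>Gamma\<close> with \<open>Gamma (1/2) = sqrt pi\<close>.\<close>
  also have "unit_ball_vol (real m) * Beta (1 / 2) (real m / 2 + 1) = unit_ball_vol (real (Suc m))"
    by (auto simp: unit_ball_vol_def Beta_def Gamma_eq_zero_iff field_simps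
          Gamma_one_half_real powr_half_sqrt [symmetric] powr_add [symmetric])
  finally show ?thesis .
qed

text \<open>The volume of the parallel body at distance \<open>r\<close> of the box with half-widths \<open>a i\<close>; the summand
  of \<open>S\<close> is the volume of the part in which exactly the coordinates in \<open>S\<close> leave the box.\<close>

definition box_parallel_volume :: "'i set \<Rightarrow> ('i \<Rightarrow> real) \<Rightarrow> real \<Rightarrow> real" where
  "box_parallel_volume A a r =
    (\<Sum>S\<in>Pow A. (\<Prod>i\<in>A - S. 2 * a i) * (unit_ball_vol (real (card S)) * r ^ card S))"

lemma box_parallel_volume_nonneg:
  assumes "\<And>i. i \<in> A \<Longrightarrow> 0 \<le> a i" "0 \<le> r"
  shows "0 \<le> box_parallel_volume A a r"
  unfolding box_parallel_volume_def using assms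
  by (intro sum_nonneg mult_nonneg_nonneg prod_nonneg) auto

text \<open>The subsets of \<open>insert j A\<close> are split by membership of \<open>j\<close>:
  without \<open>j\<close> they gain the factor \<open>2 * a j\<close>, with \<open>j\<close> the
  dimension and exponent of the ball factor go up by one.\<close>

lemma box_parallel_volume_insert:
  assumes A: "finite A" "j \<notin> A"
  shows "box_parallel_volume (insert j A) a r = 2 * a j * box_parallel_volume A a r +
    (\<Sum>S\<in>Pow A. (\<Prod>i\<in>A - S. 2 * a i) * (unit_ball_vol (real (Suc (card S))) * r ^ Suc (card S)))"
proof -
  have inj: "inj_on (insert j) (Pow A)"
    using A by (auto simp: inj_on_def)
  have disj: "Pow A \<inter> insert j ` Pow A = {}"
    using A by auto
  have 1: "(\<Prod>i\<in>insert j A - S. 2 * a i) = 2 * a j * (\<Prod>i\<in>A - S. 2 * a i)" if "S \<subseteq> A" for S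
  proof -
    have "insert j A - S = insert j (A - S)" using that A by auto
    then show ?thesis using A by simp
  qed
  have 2: "insert j A - insert j S = A - S" "card (insert j S) = Suc (card S)" if "S \<subseteq> A" for S
  proof -
    show "insert j A - insert j S = A - S" using A by auto
    have "finite S" "j \<notin> S" using that A finite_subset by auto
    then show "card (insert j S) = Suc (card S)" by simp
  qed
  show ?thesis
    unfolding box_parallel_volume_def Pow_insert
    using A disj by (subst sum.union_disjoint) (auto simp: sum.reindex[OF inj] 1 2 sum_distrib_left mult.assoc)
qed

text \<open>In each summand the box factor is constant in \<open>t\<close>, and integrating the ball
  factor over the slices raises its dimension by one. The result is the second sum in
  \<open>box_parallel_volume_insert\<close>.\<close>

lemma nn_integral_box_parallel_volume:
  fixes a :: "'i \<Rightarrow> real"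
  assumes A: "finite A" and a: "\<And>i. i \<in> A \<Longrightarrow> 0 \<le> a i" and r: "0 \<le> r"
  shows "(\<integral>\<^sup>+t. indicator {-r..r} t * ennreal (box_parallel_volume A a (sqrt (r\<^sup>2 - t\<^sup>2))) \<partial>lborel) =
    ennreal (\<Sum>S\<in>Pow A. (\<Prod>i\<in>A - S. 2 * a i) * (unit_ball_vol (real (Suc (card S))) * r ^ Suc (card S)))"
proof -
  let ?c = "\<lambda>S. \<Prod>i\<in>A - S. 2 * a i"
  let ?g = "\<lambda>m t. indicator {-r..r} t * (unit_ball_vol (real m) * sqrt (r\<^sup>2 - t\<^sup>2) ^ m)"
  have c: "?c S \<ge> 0" for S using a by (intro prod_nonneg) auto
  \<comment> \<open>The indicator matters here: outside \<open>[-r, r]\<close> the argument of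
    \<open>sqrt\<close> is negative, and so is its value.\<close>
  have g: "?g m t \<ge> 0" for m t
    by (auto simp: indicator_def abs_le_square_iff[symmetric] abs_le_iff)
  have "(\<integral>\<^sup>+t. indicator {-r..r} t * ennreal (box_parallel_volume A a (sqrt (r\<^sup>2 - t\<^sup>2))) \<partial>lborel) =
    (\<integral>\<^sup>+t. (\<Sum>S\<in>Pow A. ennreal (?c S) * ennreal (?g (card S) t)) \<partial>lborel)"
  proof (rule nn_integral_cong)
    fix t :: real
    have "(\<Sum>S\<in>Pow A. ennreal (?c S) * ennreal (?g (card S) t)) = ennreal (\<Sum>S\<in>Pow A. ?c S * ?g (card S) t)"
      using c g by (simp add: ennreal_mult[symmetric] sum_ennreal del: ennreal_mult')
    also have "(\<Sum>S\<in>Pow A. ?c S * ?g (card S) t) = indicator {-r..r} t * box_parallel_volume A a (sqrt (r\<^sup>2 - t\<^sup>2))"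
      by (simp add: box_parallel_volume_def sum_distrib_left mult_ac)
    finally show "indicator {-r..r} t * ennreal (box_parallel_volume A a (sqrt (r\<^sup>2 - t\<^sup>2))) =
      (\<Sum>S\<in>Pow A. ennreal (?c S) * ennreal (?g (card S) t))"
      by (simp add: indicator_def)
  qed
  also have "\<dots> = (\<Sum>S\<in>Pow A. \<integral>\<^sup>+t. ennreal (?c S) * ennreal (?g (card S) t) \<partial>lborel)"
    by (rule nn_integral_sum) measurable
  also have "\<dots> = (\<Sum>S\<in>Pow A. ennreal (?c S) * ennreal (unit_ball_vol (real (Suc (card S))) * r ^ Suc (card S)))"
  proof (rule sum.cong)
    fix S
    have "(\<integral>\<^sup>+t. ennreal (?c S) * ennreal (?g (card S) t) \<partial>lborel) =
      ennreal (?c S) * (\<integral>\<^sup>+t. ennreal (?g (card S) t) \<partial>lborel)"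
      by (rule nn_integral_cmult) measurable
    then show "(\<integral>\<^sup>+t. ennreal (?c S) * ennreal (?g (card S) t) \<partial>lborel) =
       ennreal (?c S) * ennreal (unit_ball_vol (real (Suc (card S))) * r ^ Suc (card S))"
      by (simp only: nn_integral_ball_slices[OF r])
  qed simp
  also have "\<dots> = (\<Sum>S\<in>Pow A. ennreal (?c S * (unit_ball_vol (real (Suc (card S))) * r ^ Suc (card S))))"
    by (intro sum.cong refl ennreal_mult[symmetric] c) (use r in auto)
  also have "\<dots> = ennreal (\<Sum>S\<in>Pow A. ?c S * (unit_ball_vol (real (Suc (card S))) * r ^ Suc (card S)))"
    by (intro sum_ennreal mult_nonneg_nonneg c) (use r in auto)
  finally show ?thesis .
qed

text \<open>Induction over the coordinates by Fubini. Fixing the new coordinate at distance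
  \<open>d \<le> r\<close> from its interval leaves a parallel set in the others with radius
  \<open>sqrt (r\<^sup>2 - d\<^sup>2)\<close>, which is why \<open>r\<close> is generalized.\<close>

lemma emeasure_box_parallel:
  fixes a :: "'i \<Rightarrow> real"
  assumes "finite A" "\<And>i. i \<in> A \<Longrightarrow> 0 \<le> a i" "0 \<le> r"
  shows "emeasure (Pi\<^sub>M A (\<lambda>_. lborel))
      ({f. (\<Sum>i\<in>A. (dist_interval (a i) (f i))\<^sup>2) \<le> r\<^sup>2} \<inter> space (Pi\<^sub>M A (\<lambda>_. lborel))) =
    ennreal (box_parallel_volume A a r)"
  using assms
proof (induction arbitrary: r)
  case (empty r)
  then show ?case
    by (simp add: box_parallel_volume_def unit_ball_vol_def space_PiM)
next
  case (insert j A r)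
  interpret product_sigma_finite "\<lambda>_. lborel :: real measure"
    by standard
  let ?M = "\<lambda>A. Pi\<^sub>M A (\<lambda>_. lborel :: real measure)"
  let ?E = "\<lambda>A r. {f. (\<Sum>i\<in>A. (dist_interval (a i) (f i))\<^sup>2) \<le> r\<^sup>2} \<inter> space (?M A)"
  let ?F = "\<lambda>t. indicator {-r..r} t * ennreal (box_parallel_volume A a (sqrt (r\<^sup>2 - t\<^sup>2)))"
  have E_sets [measurable]: "?E B s \<in> sets (?M B)" for B s by measurable
  have pointwise: "indicator (?E (insert j A) r) (f(j := y)) =
      indicator {-r..r} (dist_interval (a j) y) * (indicator (?E A (sqrt (r\<^sup>2 - (dist_interval (a j) y)\<^sup>2))) f :: ennreal)"
    if f: "f \<in> space (?M A)" for f y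
  proof -
    let ?d = "dist_interval (a j) y" and ?q = "\<Sum>i\<in>A. (dist_interval (a i) (f i))\<^sup>2"
    have "(\<Sum>i\<in>A. (dist_interval (a i) ((f(j := y)) i))\<^sup>2) = ?q"
      using insert.hyps by (intro sum.cong) auto
    then have "f(j := y) \<in> ?E (insert j A) r \<longleftrightarrow> ?d\<^sup>2 + ?q \<le> r\<^sup>2"
      using insert.hyps f by (auto simp: space_PiM PiE_def extensional_def)
    moreover have "?d\<^sup>2 + ?q \<le> r\<^sup>2 \<longleftrightarrow> ?d \<in> {-r..r} \<and> f \<in> ?E A (sqrt (r\<^sup>2 - ?d\<^sup>2))"
    proof -
      have "?q \<ge> 0" by (intro sum_nonneg) auto
      moreover have "?d \<in> {-r..r} \<longleftrightarrow> ?d\<^sup>2 \<le> r\<^sup>2"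
        using insert.prems(2) order_trans[of "- r" 0 "dist_interval (a j) y"]
        by (auto simp: abs_le_square_iff[symmetric] abs_le_iff)
      ultimately show ?thesis using f by auto
    qed
    ultimately show ?thesis by (auto simp: indicator_def)
  qed
  have "emeasure (?M (insert j A)) (?E (insert j A) r) =
      (\<integral>\<^sup>+f. indicator (?E (insert j A) r) f \<partial>?M (insert j A))"
    by (rule nn_integral_indicator[symmetric]) measurable
  also have "\<dots> = (\<integral>\<^sup>+y. \<integral>\<^sup>+f. indicator (?E (insert j A) r) (f(j := y)) \<partial>?M A \<partial>lborel)"
    using insert.hyps by (intro product_nn_integral_insert_rev) measurable
  also have "\<dots> = (\<integral>\<^sup>+y. \<integral>\<^sup>+f. indicator {-r..r} (dist_interval (a j) y) *
      indicator (?E A (sqrt (r\<^sup>2 - (dist_interval (a j) y)\<^sup>2))) f \<partial>?M A \<partial>lborel)"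
    by (intro nn_integral_cong pointwise)
  also have "\<dots> = (\<integral>\<^sup>+y. ?F (dist_interval (a j) y) \<partial>lborel)"
  proof (rule nn_integral_cong)
    fix y
    let ?d = "dist_interval (a j) y"
    have "(\<integral>\<^sup>+f. indicator {-r..r} ?d * indicator (?E A (sqrt (r\<^sup>2 - ?d\<^sup>2))) f \<partial>?M A) =
      indicator {-r..r} ?d * emeasure (?M A) (?E A (sqrt (r\<^sup>2 - ?d\<^sup>2)))"
      by (rule nn_integral_cmult_indicator) measurable
    also have "\<dots> = ?F ?d"
    proof (cases "?d \<in> {-r..r}")
      case True
      then have "?d\<^sup>2 \<le> r\<^sup>2" by (auto simp: abs_le_square_iff[symmetric] abs_le_iff)
      then show ?thesis using insert.IH[of "sqrt (r\<^sup>2 - ?d\<^sup>2)"] insert.prems by simp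
    qed simp
    finally show "(\<integral>\<^sup>+f. indicator {-r..r} ?d * indicator (?E A (sqrt (r\<^sup>2 - ?d\<^sup>2))) f \<partial>?M A) = ?F ?d" .
  qed
  \<comment> \<open>The first term collects the points whose coordinate \<open>j\<close> stays in
    its interval, the integral those where it leaves; they become the two parts of
    \<open>box_parallel_volume_insert\<close>.\<close>
  also have "\<dots> = ennreal (2 * a j) * ?F 0 + (\<integral>\<^sup>+t. ?F \<bar>t\<bar> \<partial>lborel)"
  proof (rule nn_integral_dist_interval)
    show "?F \<in> borel_measurable borel"
      unfolding box_parallel_volume_def by (rule borel_measurable_times_ennreal) (simp, measurable)
  qed (use insert.prems in auto)
  also have "(\<integral>\<^sup>+t. ?F \<bar>t\<bar> \<partial>lborel) = (\<integral>\<^sup>+t. ?F t \<partial>lborel)"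
    by (intro nn_integral_cong) (auto simp: indicator_def abs_if)
  also have "\<dots> = ennreal (\<Sum>S\<in>Pow A. (\<Prod>i\<in>A - S. 2 * a i) *
      (unit_ball_vol (real (Suc (card S))) * r ^ Suc (card S)))"
    using insert.hyps insert.prems by (intro nn_integral_box_parallel_volume) auto
  also have "?F 0 = ennreal (box_parallel_volume A a r)"
    using insert.prems by simp
  also have "ennreal (2 * a j) * \<dots> + ennreal (\<Sum>S\<in>Pow A. (\<Prod>i\<in>A - S. 2 * a i) *
      (unit_ball_vol (real (Suc (card S))) * r ^ Suc (card S))) =
    ennreal (box_parallel_volume (insert j A) a r)"
  proof -
    have "0 \<le> (\<Sum>S\<in>Pow A. (\<Prod>i\<in>A - S. 2 * a i) * (unit_ball_vol (real (Suc (card S))) * r ^ Suc (card S)))"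
      using insert.prems by (intro sum_nonneg mult_nonneg_nonneg prod_nonneg) auto
    then show ?thesis
      using insert.prems insert.hyps box_parallel_volume_nonneg[of A a r]
      by (simp add: box_parallel_volume_insert ennreal_mult ennreal_plus)
  qed
  finally show ?case .
qed

section \<open>Parallel bodies of boxes in Euclidean space\<close>

lemma power2_norm_eq_sum:
  fixes x :: "'a::euclidean_space"
  shows "(norm x)\<^sup>2 = (\<Sum>i\<in>Basis. (x \<bullet> i)\<^sup>2)"
  unfolding power2_norm_eq_inner by (subst euclidean_inner) (simp add: power2_eq_square)

text \<open>Both sides describe the points at distance at most \<open>r\<close> from the box. One
  inclusion bounds each coordinate distance by the displacement; the other moves from
  \<open>z\<close> to its nearest point in the box.\<close>

lemma cbox_plus_cball:
  fixes a :: "'a::euclidean_space"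
  assumes a: "\<And>i. i \<in> Basis \<Longrightarrow> 0 \<le> a \<bullet> i" and r: "0 \<le> r"
  shows "{x + r *\<^sub>R b | x b. x \<in> cbox (- a) a \<and> b \<in> cball 0 1} =
    {x. (\<Sum>i\<in>Basis. (dist_interval (a \<bullet> i) (x \<bullet> i))\<^sup>2) \<le> r\<^sup>2}"
proof (intro equalityI subsetI)
  fix z assume "z \<in> {x + r *\<^sub>R b | x b. x \<in> cbox (- a) a \<and> b \<in> cball 0 1}"
  then obtain x b where x: "x \<in> cbox (- a) a" and b: "norm b \<le> 1" and z: "z = x + r *\<^sub>R b"
    by auto
  have "(\<Sum>i\<in>Basis. (dist_interval (a \<bullet> i) (z \<bullet> i))\<^sup>2) \<le> (\<Sum>i\<in>Basis. ((r *\<^sub>R b) \<bullet> i)\<^sup>2)"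
  proof (rule sum_mono)
    fix i :: 'a assume i: "i \<in> Basis"
    then have "- (a \<bullet> i) \<le> x \<bullet> i" "x \<bullet> i \<le> a \<bullet> i" using x by (simp_all add: mem_box)
    then have "dist_interval (a \<bullet> i) (z \<bullet> i) \<le> \<bar>(r *\<^sub>R b) \<bullet> i\<bar>"
      unfolding z inner_add_left dist_interval_def by linarith
    then show "(dist_interval (a \<bullet> i) (z \<bullet> i))\<^sup>2 \<le> ((r *\<^sub>R b) \<bullet> i)\<^sup>2"
      by (simp add: abs_le_square_iff[symmetric])
  qed
  also have "\<dots> = (norm (r *\<^sub>R b))\<^sup>2"
    by (rule power2_norm_eq_sum[symmetric])
  also have "\<dots> \<le> r\<^sup>2"
    using b r by (intro power_mono) (auto simp: mult_left_le)
  finally show "z \<in> {x. (\<Sum>i\<in>Basis. (dist_interval (a \<bullet> i) (x \<bullet> i))\<^sup>2) \<le> r\<^sup>2}" by simp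
next
  fix z assume "z \<in> {x. (\<Sum>i\<in>Basis. (dist_interval (a \<bullet> i) (x \<bullet> i))\<^sup>2) \<le> r\<^sup>2}"
  then have z: "(\<Sum>i\<in>Basis. (dist_interval (a \<bullet> i) (z \<bullet> i))\<^sup>2) \<le> r\<^sup>2" by simp
  \<comment> \<open>Clamping every coordinate to its interval gives the point of the box nearest to
    \<open>z\<close>.\<close>
  define x where "x = (\<Sum>i\<in>Basis. max (- (a \<bullet> i)) (min (a \<bullet> i) (z \<bullet> i)) *\<^sub>R i)"
  have xi: "x \<bullet> i = max (- (a \<bullet> i)) (min (a \<bullet> i) (z \<bullet> i))" if "i \<in> Basis" for i
    using that by (simp add: x_def)
  have x: "x \<in> cbox (- a) a" using a by (auto simp: mem_box xi)
  have "(norm (z - x))\<^sup>2 = (\<Sum>i\<in>Basis. ((z - x) \<bullet> i)\<^sup>2)"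
    by (rule power2_norm_eq_sum)
  also have "\<dots> = (\<Sum>i\<in>Basis. (dist_interval (a \<bullet> i) (z \<bullet> i))\<^sup>2)"
  proof (rule sum.cong)
    fix i :: 'a assume i: "i \<in> Basis"
    have "\<bar>(z - x) \<bullet> i\<bar> = \<bar>dist_interval (a \<bullet> i) (z \<bullet> i)\<bar>"
      using a[OF i] unfolding inner_diff_left xi[OF i] dist_interval_def by linarith
    then show "((z - x) \<bullet> i)\<^sup>2 = (dist_interval (a \<bullet> i) (z \<bullet> i))\<^sup>2"
      by (metis power2_abs)
  qed simp
  finally have "(norm (z - x))\<^sup>2 \<le> r\<^sup>2" using z by simp
  then have zx: "norm (z - x) \<le> r" using r by (rule power2_le_imp_le)
  \<comment> \<open>For \<open>r = 0\<close> division by zero makes \<open>b = 0\<close>, and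
    \<open>zx\<close> then forces \<open>z = x\<close>.\<close>
  define b where "b = (1 / r) *\<^sub>R (z - x)"
  have "norm b = norm (z - x) / r" unfolding b_def norm_scaleR using r by simp
  then have "norm b \<le> 1" using zx r by (simp add: divide_le_eq)
  moreover have "z = x + r *\<^sub>R b"
    using zx by (cases "r = 0") (auto simp: b_def)
  ultimately show "z \<in> {x + r *\<^sub>R b | x b. x \<in> cbox (- a) a \<and> b \<in> cball 0 1}"
    using x by auto
qed

text \<open>Sorting the summands of \<open>box_parallel_volume\<close> by the number of coordinates
  that stay inside the box collects the elementary symmetric polynomials of the side
  lengths.\<close>

lemma steiner_formula_cbox:
  fixes a :: "'a::euclidean_space"
  assumes a: "\<And>i. i \<in> Basis \<Longrightarrow> 0 \<le> a \<bullet> i"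
  shows "steiner_formula (cbox (- a) a) (\<lambda>k. \<Sum>T | T \<subseteq> Basis \<and> card T = k. \<Prod>i\<in>T. 2 * (a \<bullet> i))"
  unfolding steiner_formula_def
proof (intro allI impI)
  fix r :: real assume r: "0 \<le> r"
  let ?E = "{x :: 'a. (\<Sum>i\<in>Basis. (dist_interval (a \<bullet> i) (x \<bullet> i))\<^sup>2) \<le> r\<^sup>2}"
  let ?M = "Pi\<^sub>M (Basis :: 'a set) (\<lambda>_. lborel :: real measure)"
  let ?\<phi> = "\<lambda>f. \<Sum>b\<in>Basis. f b *\<^sub>R b :: 'a"
  have E [measurable]: "?E \<in> sets borel" by measurable
  have "emeasure lborel ?E = emeasure (distr ?M borel ?\<phi>) ?E"
    by (subst lborel_eq) simp
  also have "\<dots> = emeasure ?M (?\<phi> -` ?E \<inter> space ?M)"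
    by (rule emeasure_distr) measurable
  also have "?\<phi> -` ?E = {f. (\<Sum>i\<in>Basis. (dist_interval (a \<bullet> i) (f i))\<^sup>2) \<le> r\<^sup>2}"
    by auto
  also have "emeasure ?M (\<dots> \<inter> space ?M) = ennreal (box_parallel_volume Basis (\<lambda>i. a \<bullet> i) r)"
    using a r by (intro emeasure_box_parallel) auto
  finally have volume: "measure lebesgue ?E = box_parallel_volume Basis (\<lambda>i. a \<bullet> i) r"
    using box_parallel_volume_nonneg[of Basis "\<lambda>i. a \<bullet> i" r] a r
    by (simp add: measure_completion measure_def)
  have card_le: "card S \<le> DIM('a)" if "S \<subseteq> Basis" for S :: "'a set"
    using that by (intro card_mono) auto
  \<comment> \<open>Passing to complements: \<open>T = Basis - S\<close> holds the coordinates
    inside the box, and the ball dimension becomes \<open>DIM('a) - card T\<close>.\<close>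
  have "box_parallel_volume Basis (\<lambda>i. a \<bullet> i) r = (\<Sum>T\<in>Pow Basis. (\<Prod>i\<in>T. 2 * (a \<bullet> i)) *
      (unit_ball_vol (real (DIM('a) - card T)) * r ^ (DIM('a) - card T)))"
    unfolding box_parallel_volume_def
    by (rule sum.reindex_bij_witness[of _ "\<lambda>T. Basis - T" "\<lambda>T. Basis - T"])
       (auto simp: card_Diff_subset finite_subset[OF _ finite_Basis] double_diff card_le of_nat_diff)
  also have "\<dots> = (\<Sum>k = 0..DIM('a). \<Sum>T | T \<in> Pow Basis \<and> card T = k. (\<Prod>i\<in>T. 2 * (a \<bullet> i)) *
      (unit_ball_vol (real (DIM('a) - card T)) * r ^ (DIM('a) - card T)))"
    by (rule sum.group[symmetric]) (auto simp: card_le)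
  also have "\<dots> = (\<Sum>k = 0..DIM('a). r ^ (DIM('a) - k) * unit_ball_vol (real (DIM('a) - k)) *
      (\<Sum>T | T \<subseteq> Basis \<and> card T = k. \<Prod>i\<in>T. 2 * (a \<bullet> i)))"
    by (intro sum.cong) (auto simp: sum_distrib_left mult_ac intro!: sum.cong)
  finally show "measure lebesgue {x + r *\<^sub>R b | x b. x \<in> cbox (- a) a \<and> b \<in> cball 0 1} =
     (\<Sum>k = 0..DIM('a). r ^ (DIM('a) - k) * unit_ball_vol (real (DIM('a) - k)) *
      (\<Sum>T | T \<subseteq> Basis \<and> card T = k. \<Prod>i\<in>T. 2 * (a \<bullet> i)))"
    by (simp only: cbox_plus_cball[OF a r] volume)
qed

lemma intrinsic_volume_cbox:
  fixes a :: "'a::euclidean_space"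
  assumes "\<And>i. i \<in> Basis \<Longrightarrow> 0 \<le> a \<bullet> i" "k \<le> DIM('a)"
  shows "intrinsic_volume k (cbox (- a) a) = (\<Sum>T | T \<subseteq> Basis \<and> card T = k. \<Prod>i\<in>T. 2 * (a \<bullet> i))"
  using intrinsic_volume_eqI[OF steiner_formula_cbox] assms by blast

subsection \<open>The p-combination of two cubes\<close>

lemma support_function_cbox:
  fixes a y :: "'a::euclidean_space"
  assumes "\<And>i. i \<in> Basis \<Longrightarrow> a \<bullet> i \<ge> 0"
  shows "support_function (cbox (- a) a) y = (\<Sum>i\<in>Basis. a \<bullet> i * \<bar>y \<bullet> i\<bar>)"
  unfolding support_function_def
proof (rule cSup_eq_maximum)
  \<comment> \<open>The signs of \<open>y\<close> choose a maximizer; where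
    \<open>y \<bullet> i = 0\<close> any admissible coordinate would do, and \<open>sgn\<close>
    gives \<open>0\<close>.\<close>
  define x where "x = (\<Sum>i\<in>Basis. (sgn (y \<bullet> i) * (a \<bullet> i)) *\<^sub>R i)"
  have x: "x \<bullet> i = sgn (y \<bullet> i) * (a \<bullet> i)" if "i \<in> Basis" for i
    using that by (simp add: x_def)
  have "x \<in> cbox (- a) a"
    unfolding mem_box
  proof
    fix i :: 'a assume "i \<in> Basis"
    then show "- a \<bullet> i \<le> x \<bullet> i \<and> x \<bullet> i \<le> a \<bullet> i"
      using assms[of i] by (simp add: x sgn_real_def)
  qed
  moreover have "y \<bullet> x = (\<Sum>i\<in>Basis. a \<bullet> i * \<bar>y \<bullet> i\<bar>)"
    by (subst euclidean_inner) (auto simp: x sgn_real_def intro!: sum.cong)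
  ultimately show "(\<Sum>i\<in>Basis. a \<bullet> i * \<bar>y \<bullet> i\<bar>) \<in> (\<lambda>x. y \<bullet> x) ` cbox (- a) a"
    by (metis imageI)
next
  fix z assume "z \<in> (\<lambda>x. y \<bullet> x) ` cbox (- a) a"
  then obtain x where x: "x \<in> cbox (- a) a" "z = y \<bullet> x" by auto
  have "z = (\<Sum>i\<in>Basis. (y \<bullet> i) * (x \<bullet> i))"
    unfolding x(2) by (rule euclidean_inner)
  also have "\<dots> \<le> (\<Sum>i\<in>Basis. a \<bullet> i * \<bar>y \<bullet> i\<bar>)"
  proof (rule sum_mono)
    fix i :: 'a assume "i \<in> Basis"
    then have "\<bar>x \<bullet> i\<bar> \<le> a \<bullet> i" using x unfolding mem_box by (auto simp: abs_le_iff)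
    then have "\<bar>y \<bullet> i\<bar> * \<bar>x \<bullet> i\<bar> \<le> \<bar>y \<bullet> i\<bar> * (a \<bullet> i)"
      by (intro mult_left_mono) auto
    then show "(y \<bullet> i) * (x \<bullet> i) \<le> a \<bullet> i * \<bar>y \<bullet> i\<bar>"
      by (metis abs_le_D1 abs_mult mult.commute)
  qed
  finally show "z \<le> (\<Sum>i\<in>Basis. a \<bullet> i * \<bar>y \<bullet> i\<bar>)" .
qed

text \<open>The right side is the tangent at \<open>1\<close> of the concave function
  \<open>x powr p\<close>; the bound is weighted AM-GM for \<open>x\<close> and \<open>1\<close>. It
  serves both the reverse Minkowski inequality and the threshold on \<open>p\<close>.\<close>

lemma powr_le_Bernoulli:
  fixes x p :: real
  assumes "0 \<le> x" "0 < p" "p \<le> 1"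
  shows "x powr p \<le> 1 + p * (x - 1)"
proof (cases "x = 0")
  case False
  with Youngs_inequality_0[of p "1 - p" x 1] assms show ?thesis
    by (simp add: algebra_simps)
qed (use assms in simp)

text \<open>The case \<open>f = (S, S)\<close>, \<open>g = (a, b)\<close> of the reverse Minkowski inequality in \<open>L\<^sup>p\<close> of two points of
  mass \<open>1/2\<close>, with the \<open>L\<^sup>p\<close> norm of \<open>g\<close> bounded from below by \<open>a\<^sup>p + b\<^sup>p \<ge> (a + b)\<^sup>p\<close>.\<close>

lemma reverse_Minkowski:
  fixes S a b p :: real
  assumes S: "0 \<le> S" and a: "0 \<le> a" and b: "0 \<le> b" and p: "0 < p" "p \<le> 1"
  shows "S + (1/2) powr (1/p) * (a + b) \<le> (1/2 * (S + a) powr p + 1/2 * (S + b) powr p) powr (1/p)"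
\<comment> \<open>The case \<open>a = b = 0\<close> is separate since the main case divides by
  \<open>c\<close>, a multiple of \<open>a + b\<close>.\<close>
proof (cases "a + b = 0")
  case True
  with a b have "a = 0" "b = 0" by auto
  then show ?thesis using p S by (simp add: powr_powr)
next
  case False
  \<comment> \<open>\<open>c\<close> is the lower bound for the p-mean of \<open>a\<close> and
    \<open>b\<close>, established as \<open>cab\<close>; \<open>w\<close> is the left side of the
    claim.\<close>
  define c where "c = (1/2) powr (1/p) * (a + b)"
  define w where "w = S + c"
  have ab: "a + b > 0" using False a b by simp
  then have c: "c > 0" by (simp add: c_def)
  then have w: "w > 0" using S by (simp add: w_def)
  have cp: "c powr p = 1/2 * (a + b) powr p"
    using p ab by (simp add: c_def powr_mult powr_powr)
  \<comment> \<open>Subadditivity of \<open>x powr p\<close>: on \<open>[0, 1]\<close> the power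
    dominates its base, and the two fractions add up to \<open>1\<close>.\<close>
  have "x / (a + b) \<le> (x / (a + b)) powr p" if "0 \<le> x" "x \<le> a + b" for x
    using powr_mono'[of p 1 "x / (a + b)"] that p ab by simp
  from this[of a] this[of b] have "1 \<le> (a / (a + b)) powr p + (b / (a + b)) powr p"
    using a b ab by (smt (verit) add_divide_distrib divide_self)
  then have "1 \<le> (a powr p + b powr p) / (a + b) powr p"
    using ab a b by (simp add: powr_divide add_divide_distrib)
  then have "(a + b) powr p \<le> a powr p + b powr p"
    using ab by (simp add: le_divide_eq)
  then have cab: "2 * c powr p \<le> a powr p + b powr p" using cp by simp
  \<comment> \<open>Concavity of \<open>x powr p\<close>: \<open>(S + x) / w\<close> is the convex combination of \<open>1\<close> and \<open>x / c\<close> with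
    weights \<open>S / w\<close> and \<open>c / w\<close>.\<close>
  have conc: "S * w powr p + c * w powr p * (x / c) powr p \<le> w * (S + x) powr p" if x: "0 \<le> x" for x
  proof (cases "S + x = 0")
    case True
    then have "S = 0" "x = 0" using x S by auto
    then show ?thesis using p by simp
  next
    case False
    define v where "v = S + x"
    have v: "v > 0" using False x S by (simp add: v_def)
    \<comment> \<open>Both points are rescaled by \<open>w / v\<close>, so that their convex
      combination becomes \<open>1\<close>, the point of tangency; the linear terms then cancel in
      the sum with weights \<open>S\<close> and \<open>c\<close>.\<close>
    have "(w / v) powr p \<le> 1 + p * (w / v - 1)"
      using w v p by (intro powr_le_Bernoulli) auto
    moreover have "(w * (x / c) / v) powr p \<le> 1 + p * (w * (x / c) / v - 1)"
      using w v p x c by (intro powr_le_Bernoulli) auto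
    ultimately have "S * (w / v) powr p + c * (w * (x / c) / v) powr p
        \<le> S * (1 + p * (w / v - 1)) + c * (1 + p * (w * (x / c) / v - 1))"
      using S c by (intro add_mono mult_left_mono) auto
    also have "\<dots> = w + p * (w * ((S + c * (x / c)) / v) - w)"
      by (simp add: w_def algebra_simps add_divide_distrib)
    also have "(S + c * (x / c)) / v = 1" using v c by (simp add: v_def)
    finally have "S * (w / v) powr p + c * (w * (x / c) / v) powr p \<le> w" by simp
    also have "(w * (x / c) / v) powr p = w powr p * (x / c) powr p / v powr p"
      using w v c x by (simp add: powr_divide powr_mult)
    also have "(w / v) powr p = w powr p / v powr p"
      using w v by (simp add: powr_divide)
    finally have "(S * w powr p + c * w powr p * (x / c) powr p) / v powr p \<le> w"
      by (simp add: add_divide_distrib mult.assoc)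
    then show ?thesis
      using v by (simp add: v_def[symmetric] pos_divide_le_eq)
  qed
  \<comment> \<open>Since \<open>2 * w = 2 * S + 2 * c\<close>, only the term in \<open>c\<close>
    needs a bound, which is \<open>cab\<close> divided by \<open>c powr p\<close>.\<close>
  have "2 * w * w powr p \<le> 2 * S * w powr p + w powr p * (c * ((a / c) powr p + (b / c) powr p))"
  proof -
    have "2 \<le> (a powr p + b powr p) / c powr p"
      using cab c by (simp add: le_divide_eq)
    then have "2 \<le> (a / c) powr p + (b / c) powr p"
      using c a b by (simp add: powr_divide add_divide_distrib)
    then have "w powr p * (c * 2) \<le> w powr p * (c * ((a / c) powr p + (b / c) powr p))"
      using c by (intro mult_left_mono) auto
    then show ?thesis by (simp add: w_def algebra_simps)
  qed
  also have "\<dots> \<le> w * (S + a) powr p + w * (S + b) powr p"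
    using conc[OF a] conc[OF b] by (simp add: algebra_simps)
  finally have "w * (w powr p) \<le> w * (1/2 * (S + a) powr p + 1/2 * (S + b) powr p)"
    by (simp add: algebra_simps)
  then have "w powr p \<le> 1/2 * (S + a) powr p + 1/2 * (S + b) powr p"
    using w mult_le_cancel_left_pos by blast
  then have "(w powr p) powr (1/p) \<le> (1/2 * (S + a) powr p + 1/2 * (S + b) powr p) powr (1/p)"
    using p by (intro powr_mono2) auto
  then show ?thesis using p w by (simp add: powr_powr w_def c_def)
qed

section \<open>The Wulff shape of the two cubes\<close>

lemma inner_sum_Basis_subset:
  assumes C: "C \<subseteq> Basis" and i: "i \<in> Basis"
  shows "(\<Sum>C) \<bullet> i = of_bool (i \<in> C)"
proof -
  have "finite C" using C finite_Basis by (rule finite_subset)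
  have "(\<Sum>C) \<bullet> i = (\<Sum>j\<in>C. of_bool (j = i))"
    unfolding inner_sum_left using C i
    by (intro sum.cong) (auto simp: inner_Basis subset_iff)
  also have "\<dots> = of_bool (i \<in> C)"
    using \<open>finite C\<close> by simp
  finally show ?thesis .
qed

text \<open>The constraints in the signed basis directions already cut out the box: its half-widths
  are the values of the p-mean there. No other direction cuts off more, since
  \<open>reverse_Minkowski\<close> bounds the support function of the box by the p-mean.\<close>

lemma p_combination_boxes:
  fixes u v :: "'a::euclidean_space" and C :: "'a set"
  assumes C: "C \<subseteq> Basis" and u: "u \<in> Basis - C" and v: "v \<in> Basis - C" and "u \<noteq> v"
    and p: "0 < p" "p \<le> 1"
  defines "s \<equiv> (1/2) powr (1/p)"
  shows "p_combination p (1/2) (cbox (- (u + \<Sum>C)) (u + \<Sum>C)) (cbox (- (v + \<Sum>C)) (v + \<Sum>C)) =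
    cbox (- (s *\<^sub>R (u + v) + \<Sum>C)) (s *\<^sub>R (u + v) + \<Sum>C)"
proof -
  have SC: "(\<Sum>C) \<bullet> i = of_bool (i \<in> C)" if "i \<in> Basis" for i
    by (rule inner_sum_Basis_subset[OF C that])
  \<comment> \<open>For nonnegative \<open>a\<close>, \<open>h a\<close> is the support function of
    \<open>cbox (- a) a\<close>. As a formula it is linear in \<open>a\<close>, so it can be
    computed summand by summand.\<close>
  define h where "h a y = (\<Sum>i\<in>Basis. a \<bullet> i * \<bar>y \<bullet> i\<bar>)" for a y :: 'a
  define S where "S y = (\<Sum>i\<in>C. \<bar>y \<bullet> i\<bar>)" for y :: 'a
  have h_add: "h (a + b) y = h a y + h b y" and h_scale: "h (r *\<^sub>R a) y = r * h a y"
    for a b y r by (simp_all add: h_def inner_left_distrib sum.distrib algebra_simps sum_distrib_left)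
  have h_Basis: "h w y = \<bar>y \<bullet> w\<bar>" if "w \<in> Basis" for w y
  proof -
    have "h w y = (\<Sum>i\<in>Basis. if i = w then \<bar>y \<bullet> w\<bar> else 0)"
      unfolding h_def using that by (intro sum.cong) (auto simp: inner_Basis)
    then show ?thesis using that by simp
  qed
  have h_C: "h (\<Sum>C) y = S y" for y
  proof -
    have "h (\<Sum>C) y = (\<Sum>i\<in>Basis. if i \<in> C then \<bar>y \<bullet> i\<bar> else 0)"
      unfolding h_def by (intro sum.cong) (auto simp: SC)
    also have "\<dots> = S y" using C by (simp add: S_def sum.inter_restrict[symmetric] Int_absorb1)
    finally show ?thesis .
  qed
  have S0: "S y \<ge> 0" for y by (simp add: S_def sum_nonneg)
  have s0: "0 \<le> s" by (simp add: s_def)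
  have sp: "support_function (cbox (- (w + \<Sum>C)) (w + \<Sum>C)) y = S y + \<bar>y \<bullet> w\<bar>"
    if w: "w \<in> Basis" for w y
  proof -
    have "support_function (cbox (- (w + \<Sum>C)) (w + \<Sum>C)) y = h (w + \<Sum>C) y"
      unfolding h_def using w
      by (intro support_function_cbox) (auto simp: inner_left_distrib SC inner_Basis)
    then show ?thesis by (simp add: h_add h_C h_Basis[OF w])
  qed
  define b where "b = s *\<^sub>R (u + v) + \<Sum>C"
  have hb: "h b y = S y + s * (\<bar>y \<bullet> u\<bar> + \<bar>y \<bullet> v\<bar>)" for y
    using u v by (simp add: b_def h_add h_scale h_Basis h_C)
  have comb: "x \<in> p_combination p (1/2) (cbox (- (u + \<Sum>C)) (u + \<Sum>C)) (cbox (- (v + \<Sum>C)) (v + \<Sum>C)) \<longleftrightarrow>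
    (\<forall>y\<in>sphere 0 1. x \<bullet> y \<le> (1/2 * (S y + \<bar>y \<bullet> u\<bar>) powr p + 1/2 * (S y + \<bar>y \<bullet> v\<bar>) powr p) powr (1/p))" for x
  proof -
    have "u \<in> Basis" "v \<in> Basis" using u v by auto
    then show ?thesis unfolding p_combination_def sp[OF \<open>u \<in> Basis\<close>] sp[OF \<open>v \<in> Basis\<close>] by simp
  qed
  show ?thesis
    unfolding b_def[symmetric]
  proof (intro equalityI subsetI)
    fix x assume x: "x \<in> cbox (- b) b"
    have "x \<bullet> y \<le> (1/2 * (S y + \<bar>y \<bullet> u\<bar>) powr p + 1/2 * (S y + \<bar>y \<bullet> v\<bar>) powr p) powr (1/p)" for y
    proof -
      have "x \<bullet> y = (\<Sum>i\<in>Basis. (x \<bullet> i) * (y \<bullet> i))" by (rule euclidean_inner)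
      also have "\<dots> \<le> h b y" unfolding h_def
      proof (rule sum_mono)
        fix i :: 'a assume "i \<in> Basis"
        then have "- (b \<bullet> i) \<le> x \<bullet> i" "x \<bullet> i \<le> b \<bullet> i"
          using x by (simp_all add: mem_box)
        then have "\<bar>x \<bullet> i\<bar> * \<bar>y \<bullet> i\<bar> \<le> b \<bullet> i * \<bar>y \<bullet> i\<bar>"
          by (intro mult_right_mono) auto
        then show "(x \<bullet> i) * (y \<bullet> i) \<le> b \<bullet> i * \<bar>y \<bullet> i\<bar>"
          by (metis abs_le_D1 abs_mult)
      qed
      finally show ?thesis
        using reverse_Minkowski[OF S0 _ _ p, of "\<bar>y \<bullet> u\<bar>" "\<bar>y \<bullet> v\<bar>" y] by (simp add: hb s_def)
    qed
    then show "x \<in> p_combination p (1/2) (cbox (- (u + \<Sum>C)) (u + \<Sum>C)) (cbox (- (v + \<Sum>C)) (v + \<Sum>C))"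
      unfolding comb by blast
  next
    fix x assume "x \<in> p_combination p (1/2) (cbox (- (u + \<Sum>C)) (u + \<Sum>C)) (cbox (- (v + \<Sum>C)) (v + \<Sum>C))"
    then have x: "x \<bullet> y \<le> (1/2 * (S y + \<bar>y \<bullet> u\<bar>) powr p + 1/2 * (S y + \<bar>y \<bullet> v\<bar>) powr p) powr (1/p)"
      if "norm y = 1" for y
      using that unfolding comb by simp
    have "\<bar>x \<bullet> i\<bar> \<le> b \<bullet> i" if i: "i \<in> Basis" for i
    proof -
      have Si: "S i = of_bool (i \<in> C)"
        using i h_C[of i] by (simp add: h_def inner_Basis SC if_distrib[of abs] if_distrib[of "\<lambda>t. _ * t"] cong: if_cong)
      \<comment> \<open>At \<open>u\<close> and \<open>v\<close> one cube has support
        \<open>1\<close> and the other \<open>0\<close>, so the p-mean is \<open>s\<close>; on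
        \<open>C\<close> both supports are \<open>1\<close>, in the remaining basis directions both
        are \<open>0\<close>.\<close>
      have bi: "(1/2 * (S i + \<bar>i \<bullet> u\<bar>) powr p + 1/2 * (S i + \<bar>i \<bullet> v\<bar>) powr p) powr (1/p) = b \<bullet> i"
        using i u v \<open>u \<noteq> v\<close> p by (auto simp: Si b_def inner_left_distrib SC inner_Basis s_def)
      have "S (- i) = S i" by (simp add: S_def)
      then show ?thesis
        using x[of i] x[of "- i"] i bi by (auto simp: abs_le_iff)
    qed
    then show "x \<in> cbox (- b) b" by (force simp: mem_box abs_le_iff)
  qed
qed

subsection \<open>Failure of the inequality\<close>

lemma convex_body_cbox:
  assumes "\<And>i. i \<in> Basis \<Longrightarrow> 0 \<le> a \<bullet> i"
  shows "convex_body (cbox (- a) a)"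
  using assms by (auto simp: convex_body_def box_ne_empty inner_minus_left intro: order_trans[of _ 0])

lemma origin_symmetric_cbox: "origin_symmetric (cbox (- a) a)"
proof -
  have "x \<in> cbox (- a) a" if "- x \<in> cbox (- a) a" for x
    using that by (force simp: mem_box)
  moreover have "- x \<in> cbox (- a) a" if "x \<in> cbox (- a) a" for x
    using that by (force simp: mem_box)
  ultimately show ?thesis
    unfolding origin_symmetric_def by (force simp: image_iff)
qed

text \<open>All summands of the elementary symmetric polynomial are nonnegative, and the one for
  \<open>T\<close> alone reaches the bound.\<close>

lemma intrinsic_volume_cbox_ge:
  fixes a :: "'a::euclidean_space"
  assumes a: "\<And>i. i \<in> Basis \<Longrightarrow> 0 \<le> a \<bullet> i" and T: "T \<subseteq> Basis" "\<And>i. i \<in> T \<Longrightarrow> 1 \<le> a \<bullet> i"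
  shows "2 ^ card T \<le> intrinsic_volume (card T) (cbox (- a) a)"
proof -
  have "2 ^ card T = (\<Prod>i\<in>T. 2 :: real)" by simp
  also have "\<dots> \<le> (\<Prod>i\<in>T. 2 * (a \<bullet> i))"
    using T by (intro prod_mono) auto
  also have "\<dots> \<le> (\<Sum>U | U \<subseteq> Basis \<and> card U = card T. \<Prod>i\<in>U. 2 * (a \<bullet> i))"
    using a T by (intro member_le_sum) (auto intro!: prod_nonneg)
  also have "\<dots> = intrinsic_volume (card T) (cbox (- a) a)"
    using a T by (intro intrinsic_volume_cbox[symmetric]) (auto intro: card_mono)
  finally show ?thesis .
qed

text \<open>A set of \<open>k\<close> coordinates does not fit into \<open>C\<close>, so each of the
  \<open>DIM('a) choose k\<close> products has a half-width from outside \<open>C\<close>, bounded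
  by \<open>s\<close>; the other half-widths are at most \<open>1\<close>.\<close>

lemma intrinsic_volume_cbox_le:
  fixes a :: "'a::euclidean_space"
  assumes a: "\<And>i. i \<in> Basis \<Longrightarrow> 0 \<le> a \<bullet> i" "\<And>i. i \<in> Basis \<Longrightarrow> a \<bullet> i \<le> 1"
    and C: "C \<subseteq> Basis" "card C < k" "k \<le> DIM('a)" and s: "\<And>i. i \<in> Basis - C \<Longrightarrow> a \<bullet> i \<le> s"
  shows "intrinsic_volume k (cbox (- a) a) \<le> 2 ^ k * (real (DIM('a) choose k) * s)"
proof -
  have "(\<Prod>i\<in>T. 2 * (a \<bullet> i)) \<le> 2 ^ k * s" if T: "T \<subseteq> Basis" "card T = k" for T
  proof -
    have finT: "finite T" using T(1) finite_Basis by (rule finite_subset)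
    have "\<not> T \<subseteq> C"
      using card_mono[of C T] finite_subset[OF C(1) finite_Basis] T C by auto
    then obtain j where j: "j \<in> T" "j \<notin> C" by auto
    have "(\<Prod>i\<in>T. a \<bullet> i) = a \<bullet> j * (\<Prod>i\<in>T - {j}. a \<bullet> i)"
      using finT j by (simp add: prod.remove)
    also have "\<dots> \<le> a \<bullet> j * 1"
      using a T j by (intro mult_left_mono prod_le_1) auto
    also have "\<dots> \<le> s" using s j T by auto
    finally show ?thesis using T by (simp add: prod.distrib)
  qed
  then have "(\<Sum>T | T \<subseteq> Basis \<and> card T = k. \<Prod>i\<in>T. 2 * (a \<bullet> i)) \<le>
      real (card {T. T \<subseteq> (Basis :: 'a set) \<and> card T = k}) * (2 ^ k * s)"
    by (intro sum_bounded_above) auto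
  then show ?thesis
    using a C by (simp add: intrinsic_volume_cbox n_subsets mult_ac)
qed

text \<open>With \<open>N\<close> the number of \<open>k\<close>-subsets of the basis, the threshold
  \<open>1 / (N + 1)\<close> ensures \<open>N * s < 1\<close>; the p-combination then has
  \<open>k\<close>-th intrinsic volume below \<open>2 ^ k\<close>, the lower bound for both
  cubes.\<close>

lemma p_Brunn_Minkowski_fails:
  fixes k :: nat
  assumes k: "1 \<le> k" "k < DIM('a::euclidean_space)"
  shows "\<exists>pbar\<in>{0<..<1::real}. \<exists>K0 K1 :: 'a set.
    convex_body K0 \<and> origin_symmetric K0 \<and> convex_body K1 \<and> origin_symmetric K1 \<and>
    (\<forall>p\<in>{0<..<pbar}.
       intrinsic_volume k (p_combination p (1/2) K0 K1) powr (p / real k)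
         < 1/2 * intrinsic_volume k K0 powr (p / real k)
           + 1/2 * intrinsic_volume k K1 powr (p / real k))"
proof -
  obtain C where C: "C \<subseteq> (Basis :: 'a set)" "card C = k - 1" "finite C"
    using obtain_subset_with_card_n[of "k - 1" "Basis :: 'a set"] k by (metis less_imp_diff_less less_imp_le)
  \<comment> \<open>\<open>k < DIM('a)\<close> leaves at least two directions outside the
    \<open>k - 1\<close> in \<open>C\<close>.\<close>
  have "card (Basis - C) \<ge> 2"
    using C k by (simp add: card_Diff_subset)
  then obtain U where "U \<subseteq> Basis - C" "card U = 2"
    by (metis obtain_subset_with_card_n)
  then obtain u v where u: "u \<in> Basis - C" and v: "v \<in> Basis - C" and uv: "u \<noteq> v"
    by (auto simp: card_2_iff)
  define N where "N = real (DIM('a) choose k)"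
  define K where "K w = cbox (- (w + \<Sum>C)) (w + \<Sum>C)" for w
  have SC: "(\<Sum>C) \<bullet> i = of_bool (i \<in> C)" if "i \<in> Basis" for i
    by (rule inner_sum_Basis_subset[OF C(1) that])
  have N: "N > 0" using k by (simp add: N_def)
  have K: "convex_body (K w)" "origin_symmetric (K w)" "2 ^ k \<le> intrinsic_volume k (K w)"
    if w: "w \<in> Basis - C" for w
  proof -
    have nonneg: "0 \<le> (w + \<Sum>C) \<bullet> i" if "i \<in> Basis" for i
      using w that by (auto simp: inner_left_distrib SC inner_Basis)
    show "convex_body (K w)" unfolding K_def by (intro convex_body_cbox nonneg)
    show "origin_symmetric (K w)" unfolding K_def by (rule origin_symmetric_cbox)
    have "card (insert w C) = k" using w C k by simp
    moreover have "2 ^ card (insert w C) \<le> intrinsic_volume (card (insert w C)) (K w)"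
      unfolding K_def
    proof (rule intrinsic_volume_cbox_ge[OF nonneg])
      show "insert w C \<subseteq> Basis" using w C by auto
      show "1 \<le> (w + \<Sum>C) \<bullet> i" if "i \<in> insert w C" for i
        using that w C by (auto simp: inner_left_distrib SC inner_Basis subset_iff)
    qed
    ultimately show "2 ^ k \<le> intrinsic_volume k (K w)" by simp
  qed
  have main: "intrinsic_volume k (p_combination p (1/2) (K u) (K v)) powr (p / real k)
         < 1/2 * intrinsic_volume k (K u) powr (p / real k)
           + 1/2 * intrinsic_volume k (K v) powr (p / real k)"
    if p: "0 < p" "p < 1 / (N + 1)" for p
  proof -
    have pN: "p * N + p < 1" using p N by (simp add: pos_less_divide_eq algebra_simps)
    then have p1: "p < 1" using N p by (smt (verit) mult_pos_pos)
    define s where "s = (1/2) powr (1/p)"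
    have s: "0 < s" "s \<le> 1" using p by (auto simp: s_def powr_le_one_le intro: powr_le1)
    \<comment> \<open>Otherwise \<open>1 \<le> (N * s) powr p = N powr p / 2\<close>, and the
      tangent bound on \<open>N powr p\<close> gives \<open>1 \<le> p * (N - 1)\<close>, contrary to
      the choice of \<open>p\<close>.\<close>
    have Ns: "N * s < 1"
    proof (rule ccontr)
      assume "\<not> N * s < 1"
      then have "1 \<le> (N * s) powr p" using p by (intro ge_one_powr_ge_zero) auto
      also have "\<dots> = N powr p / 2" using p N by (simp add: s_def powr_mult powr_powr)
      also have "N powr p \<le> 1 + p * (N - 1)" using p p1 N by (intro powr_le_Bernoulli) auto
      finally show False using pN p by (simp add: algebra_simps)
    qed
    define b where "b = s *\<^sub>R (u + v) + \<Sum>C"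
    have b: "b \<bullet> i = (if i \<in> C then 1 else if i = u \<or> i = v then s else 0)" if "i \<in> Basis" for i
      using that u v uv by (auto simp: b_def inner_left_distrib SC inner_Basis)
    have comb: "p_combination p (1/2) (K u) (K v) = cbox (- b) b"
      unfolding K_def b_def s_def using C u v uv p p1 by (intro p_combination_boxes) auto
    have "intrinsic_volume k (cbox (- b) b) \<le> 2 ^ k * (N * s)"
      unfolding N_def using C k s by (intro intrinsic_volume_cbox_le[of b C k s]) (auto simp: b)
    also have "\<dots> < 2 ^ k * 1" using Ns by (intro mult_strict_left_mono) auto
    finally have less: "intrinsic_volume k (cbox (- b) b) < 2 ^ k" by simp
    have nonneg: "0 \<le> intrinsic_volume k (cbox (- b) b)"
      using k s by (subst intrinsic_volume_cbox) (auto simp: b subset_iff intro!: sum_nonneg prod_nonneg)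
    have "intrinsic_volume k (cbox (- b) b) powr (p / k) < (2 ^ k) powr (p / k)"
      using less nonneg p k by (intro powr_less_mono2) auto
    moreover have "(2 ^ k) powr (p / k) \<le> intrinsic_volume k (K w) powr (p / k)"
      if "w \<in> Basis - C" for w
      using K(3)[OF that] p by (intro powr_mono2) auto
    from this[OF u] this[OF v]
    have "(2 ^ k) powr (p / k) \<le> 1/2 * intrinsic_volume k (K u) powr (p / k)
           + 1/2 * intrinsic_volume k (K v) powr (p / k)" by simp
    ultimately show ?thesis unfolding comb by simp
  qed
  have "1 / (N + 1) \<in> {0<..<1}" using N by simp
  then show ?thesis
    using K[OF u] K[OF v] main by (intro bexI[of _ "1 / (N + 1)"] exI[of _ "K u"] exI[of _ "K v"]) auto
qed

theorem theorem1p4: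
  fixes k :: nat
  assumes "CARD('n::finite) \<ge> 3" and "2 \<le> k" and "k \<le> CARD('n) - 1"
  shows "\<exists>pbar \<in> {0<..<1::real}. \<exists>K0 K1 :: (real ^ 'n) set.
    convex_body K0 \<and> origin_symmetric K0 \<and> convex_body K1 \<and> origin_symmetric K1 \<and>
    (\<forall>p \<in> {0<..<pbar}.
       intrinsic_volume k (p_combination p (1/2) K0 K1) powr (p / real k)
         < 1/2 * intrinsic_volume k K0 powr (p / real k)
           + 1/2 * intrinsic_volume k K1 powr (p / real k)) \<and>
    (\<forall>p \<in> {0<..<pbar}.
       \<not> (\<forall>t \<in> {0..1}. \<forall>L0 L1 :: (real ^ 'n) set.
            convex_body L0 \<and> origin_symmetric L0 \<and> convex_body L1 \<and> origin_symmetric L1 \<longrightarrow>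
            intrinsic_volume k (p_combination p t L0 L1) powr (p / real k)
              \<ge> (1 - t) * intrinsic_volume k L0 powr (p / real k)
                + t * intrinsic_volume k L1 powr (p / real k)))"
proof -
  have "1 \<le> k" "k < DIM(real ^ 'n)" using assms by auto
  from p_Brunn_Minkowski_fails[OF this] obtain pbar and K0 K1 :: "(real ^ 'n) set"
    where pbar: "pbar \<in> {0<..<1}"
      and K: "convex_body K0 \<and> origin_symmetric K0 \<and> convex_body K1 \<and> origin_symmetric K1"
      and less: "\<And>p. p \<in> {0<..<pbar} \<Longrightarrow>
        intrinsic_volume k (p_combination p (1/2) K0 K1) powr (p / real k)
          < 1/2 * intrinsic_volume k K0 powr (p / real k)
            + 1/2 * intrinsic_volume k K1 powr (p / real k)"
    by blast
  have "\<not> (\<forall>t \<in> {0..1}. \<forall>L0 L1 :: (real ^ 'n) set.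
            convex_body L0 \<and> origin_symmetric L0 \<and> convex_body L1 \<and> origin_symmetric L1 \<longrightarrow>
            intrinsic_volume k (p_combination p t L0 L1) powr (p / real k)
              \<ge> (1 - t) * intrinsic_volume k L0 powr (p / real k)
                + t * intrinsic_volume k L1 powr (p / real k))" (is "\<not> ?BM")
    if p: "p \<in> {0<..<pbar}" for p
  proof
    assume ?BM
    \<comment> \<open>The inequality is instantiated at \<open>t = 1/2\<close> with the bodies
      \<open>K0\<close> and \<open>K1\<close>, which violate it by \<open>less\<close>.\<close>
    then have "(1 - 1/2) * intrinsic_volume k K0 powr (p / real k)
        + 1/2 * intrinsic_volume k K1 powr (p / real k)
      \<le> intrinsic_volume k (p_combination p (1/2) K0 K1) powr (p / real k)"
      by (rule bspec[where x = "1/2", THEN spec[of _ K0], THEN spec[of _ K1], THEN mp]) (use K in auto)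
    with less[OF p] show False by simp
  qed
  with pbar K less show ?thesis by blast
qed

end
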